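(* Let $p$ be a prime. Every cusp for $R(p)$ is $R(p)$-equivalent to $\infty$.
   Context: $R(p)\subset\mathrm{SL}_2(\mathbb R)$ is the group of determinant-one matrices of the form $\begin{pmatrix} a & b\sqrt p\\ c\sqrt p & d\end{pmatrix}$ or $\begin{pmatrix} a\sqrt p & b\\ c & d\sqrt p\end{pmatrix}$ with $a,b,c,d\in\mathbb Z$, acting on $\mathbb H\cup\mathbb R\cup\{\infty\}$ by linear fractional transformations. A cusp for $R(p)$ is a point of $\mathbb R\cup\{\infty\}$ stabilized by a parabolic element of $R(p)$, i.e. an element different from $\pm I$ with trace $\pm2$. *)

theory Defs
  imports "HOL-Analysis.Analysis" "HOL-Computational_Algebra.Primes"
begin

definition R_group :: "nat \<Rightarrow> (real^2^2) set" where
  "R_group p = {A. det A = 1 \<and>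
     (\<exists>a b c d :: int.
        A = vector [vector [of_int a, of_int b * sqrt (real p)],
                    vector [of_int c * sqrt (real p), of_int d]] \<or>
        A = vector [vector [of_int a * sqrt (real p), of_int b],
                    vector [of_int c, of_int d * sqrt (real p)]])}"

text \<open>
  The Riemann sphere is represented by \<^typ>\<open>complex option\<close>, with \<^term>\<open>None\<close> as the point at
  infinity. Real matrices of determinant one map each of the upper half-plane and the set of
  real points together with infinity to itself.
\<close>

abbreviation pt_infinity :: "complex option" where
  "pt_infinity \<equiv> None"

definition extended_real_line :: "complex option set" where
  "extended_real_line = insert pt_infinity (Some ` \<real>)"

fun moebius :: "real^2^2 \<Rightarrow> complex option \<Rightarrow> complex option" where
  "moebius A None =
     (if A $ 2 $ 1 = 0 then pt_infinity
      else Some (of_real (A $ 1 $ 1) / of_real (A $ 2 $ 1)))"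
| "moebius A (Some z) =
     (if of_real (A $ 2 $ 1) * z + of_real (A $ 2 $ 2) = 0 then pt_infinity
      else Some ((of_real (A $ 1 $ 1) * z + of_real (A $ 1 $ 2)) /
                 (of_real (A $ 2 $ 1) * z + of_real (A $ 2 $ 2))))"

definition parabolic :: "real^2^2 \<Rightarrow> bool" where
  "parabolic A \<longleftrightarrow> A \<noteq> mat 1 \<and> A \<noteq> - mat 1 \<and> (trace A = 2 \<or> trace A = - 2)"

definition is_cusp :: "(real^2^2) set \<Rightarrow> complex option \<Rightarrow> bool" where
  "is_cusp G x \<longleftrightarrow> x \<in> extended_real_line \<and> (\<exists>A\<in>G. parabolic A \<and> moebius A x = x)"

definition equivalent_under :: "(real^2^2) set \<Rightarrow> complex option \<Rightarrow> complex option \<Rightarrow> bool" where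
  "equivalent_under G x y \<longleftrightarrow> (\<exists>A\<in>G. moebius A x = y)"

end

theory Submission
  imports Defs
begin

text \<open>
  A parabolic matrix fixing a real number \<open>r\<close> has lower left entry \<open>\<gamma> \<noteq> 0\<close>, and the fixed point
  equation has discriminant \<open>tr\<^sup>2 - 4 = 0\<close>, so \<open>2 \<gamma> r = \<alpha> - \<delta>\<close>. For a matrix in \<open>R(p)\<close> of either
  shape this says \<open>r = m \<surd>p / n\<close> with \<open>m, n\<close> coprime integers. If \<open>p\<close> does not divide \<open>n\<close>, then
  \<open>p m\<close> and \<open>n\<close> are coprime, and \<open>(n, -m \<surd>p)\<close> is the bottom row of a matrix of the second shape
  sending \<open>r\<close> to infinity; if \<open>n = p k\<close>, then \<open>m\<close> and \<open>p k\<close> are coprime, and \<open>(k \<surd>p, -m)\<close> is the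
  bottom row of a matrix of the first shape.
\<close>

lemma real_sqrt_mult_self_left: "x \<ge> 0 \<Longrightarrow> sqrt x * (sqrt x * t) = x * t"
  by (simp flip: mult.assoc)

lemma parabolic_real_fixed_point:
  assumes det: "det A = 1" and par: "parabolic A" and fixed: "moebius A (Some (of_real r)) = Some (of_real r)"
  shows "A $ 2 $ 1 \<noteq> 0" and "2 * A $ 2 $ 1 * r = A $ 1 $ 1 - A $ 2 $ 2"
proof -
  let ?a = "A $ 1 $ 1" and ?b = "A $ 1 $ 2" and ?c = "A $ 2 $ 1" and ?d = "A $ 2 $ 2"
  have d1: "?a * ?d - ?b * ?c = 1"
    using det by (simp add: det_2)
  have "(?a + ?d)\<^sup>2 = 4"
    using par by (auto simp: parabolic_def trace_def sum_2)
  \<comment> \<open>With determinant one, the left side is the squared trace minus 4, which is the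
    discriminant of \<open>?c * r\<^sup>2 + (?d - ?a) * r - ?b = 0\<close>.\<close>
  then have t: "(?a - ?d)\<^sup>2 + 4 * ?b * ?c = 0"
    using d1 by (simp add: power2_eq_square algebra_simps)
  have nz: "of_real (?c * r + ?d) \<noteq> (0 :: complex)"
    and "(of_real (?a * r + ?b) :: complex) / of_real (?c * r + ?d) = of_real r"
    using fixed by (auto split: if_splits)
  then have "of_real (?a * r + ?b) = (of_real (r * (?c * r + ?d)) :: complex)"
    by (simp add: field_simps)
  then have fp: "?a * r + ?b = r * (?c * r + ?d)"
    by (simp only: of_real_eq_iff)
  \<comment> \<open>If \<open>?c\<close> vanished, the zero discriminant would force
    \<open>?a = ?d\<close> and the fixed point equation \<open>?b = 0\<close>, leaving only plus or
    minus the identity.\<close>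
  show "?c \<noteq> 0"
  proof
    assume c: "?c = 0"
    then have "?a = ?d" using t by simp
    moreover from this have "?b = 0" using c fp by simp
    moreover have "?a = 1 \<or> ?a = - 1"
      using d1 c \<open>?a = ?d\<close> by (simp add: square_eq_1_iff)
    ultimately have "A = mat 1 \<or> A = - mat 1"
      using c by (auto simp: vec_eq_iff forall_2 mat_def)
    with par show False by (simp add: parabolic_def)
  qed
  \<comment> \<open>Completing the square: the fixed point quadratic is multiplied by
    \<open>4 * ?c\<close>. Both the discriminant and the quadratic vanish, so \<open>r\<close> is
    the double root.\<close>
  have "(2 * ?c * r - (?a - ?d))\<^sup>2 = (?a - ?d)\<^sup>2 + 4 * ?b * ?c - 4 * ?c * (?a * r + ?b - r * (?c * r + ?d))"
    by (simp add: power2_eq_square algebra_simps)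
  then show "2 * ?c * r = ?a - ?d"
    using t fp by simp
qed

lemma cusp_R_group_real:
  assumes p: "p > 0" and A: "A \<in> R_group p" and par: "parabolic A"
    and fixed: "moebius A (Some (of_real r)) = Some (of_real r)"
  obtains m n :: int where "n \<noteq> 0" "coprime m n" "of_int n * r = of_int m * sqrt (real p)"
proof -
  have det: "det A = 1" using A by (simp add: R_group_def)
  note * = parabolic_real_fixed_point[OF det par fixed]
  have "\<exists>u v :: int. v \<noteq> 0 \<and> of_int v * r = of_int u * sqrt (real p)"
  proof -
    from A obtain a b c d :: int where
      "A = vector [vector [of_int a, of_int b * sqrt (real p)],
                   vector [of_int c * sqrt (real p), of_int d]] \<or>
       A = vector [vector [of_int a * sqrt (real p), of_int b],
                   vector [of_int c, of_int d * sqrt (real p)]]"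
      unfolding R_group_def by blast
    then show ?thesis
    proof
      assume A: "A = vector [vector [of_int a, of_int b * sqrt (real p)],
                             vector [of_int c * sqrt (real p), of_int d]]"
      have "c \<noteq> 0" using *(1) A by auto
      have "2 * (of_int c * sqrt (real p)) * r = of_int (a - d)"
        using *(2) A by simp
      \<comment> \<open>In this shape the surd sits on the side of \<open>r\<close>; multiplying by
        it makes that coefficient an integer and moves the surd to the right.\<close>
      then have "sqrt (real p) * (2 * (of_int c * sqrt (real p)) * r) = of_int (a - d) * sqrt (real p)"
        by simp
      then have "of_int (2 * c * int p) * r = of_int (a - d) * sqrt (real p)"
        by (simp add: mult_ac real_sqrt_mult_self_left)
      then show ?thesis using \<open>c \<noteq> 0\<close> p
        by (intro exI[of _ "a - d"] exI[of _ "2 * c * int p"]) auto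
    next
      assume A: "A = vector [vector [of_int a * sqrt (real p), of_int b],
                             vector [of_int c, of_int d * sqrt (real p)]]"
      have "c \<noteq> 0" using *(1) A by auto
      moreover have "of_int (2 * c) * r = of_int (a - d) * sqrt (real p)"
        using *(2) A by (simp add: algebra_simps)
      ultimately show ?thesis
        by (intro exI[of _ "a - d"] exI[of _ "2 * c"]) auto
    qed
  qed
  then obtain u v :: int where v: "v \<noteq> 0" and uv: "of_int v * r = of_int u * sqrt (real p)"
    by blast
  obtain g m n where g: "u = m * g" "v = n * g" "coprime m n"
    using gcd_coprime_exists[of u v] v by (metis gcd_eq_0_iff)
  then have "g \<noteq> 0" "n \<noteq> 0" using v by auto
  moreover have "of_int g * (of_int n * r) = of_int g * (of_int m * sqrt (real p))"
    using uv unfolding g(1,2) by (simp add: mult_ac)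
  ultimately show thesis using g(3) that by simp
qed

lemma R_group_diagonal_integral:
  assumes "a * d - int p * (b * c) = 1"
  shows "vector [vector [of_int a, of_int b * sqrt (real p)],
                 vector [of_int c * sqrt (real p), of_int d]] \<in> R_group p"
proof -
  have "of_int (a * d - int p * (b * c)) = (1 :: real)"
    by (simp only: assms of_int_1)
  then show ?thesis
    by (auto simp: R_group_def det_2 algebra_simps)
qed

lemma R_group_antidiagonal_integral:
  assumes "int p * (a * d) - b * c = 1"
  shows "vector [vector [of_int a * sqrt (real p), of_int b],
                 vector [of_int c, of_int d * sqrt (real p)]] \<in> R_group p"
proof -
  have "of_int (int p * (a * d) - b * c) = (1 :: real)"
    by (simp only: assms of_int_1)
  then show ?thesis
    by (auto simp: R_group_def det_2 algebra_simps)
qed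

lemma moebius_eq_infinity:
  assumes "A $ 2 $ 1 * r + A $ 2 $ 2 = 0"
  shows "moebius A (Some (of_real r)) = pt_infinity"
proof -
  have "of_real (A $ 2 $ 1 * r + A $ 2 $ 2) = (0 :: complex)"
    by (simp only: assms of_real_0)
  then show ?thesis by simp
qed

lemma equivalent_under_R_group_infinity:
  assumes p: "prime p" and mn: "coprime m n" "n \<noteq> 0"
    and r: "of_int n * r = of_int m * sqrt (real p)"
  shows "equivalent_under (R_group p) (Some (of_real r)) pt_infinity"
proof (cases "int p dvd n")
  case True
  then obtain k where k: "n = int p * k" by blast
  \<comment> \<open>The Bezout coefficients, negated, fill the top row: the determinant becomes
    \<open>s * m + t * (int p * k)\<close>.\<close>
  obtain s t where "s * m + t * n = 1"
    using mn(1) bezout_int[of m n] by auto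
  then have "vector [vector [of_int (- s), of_int (- t) * sqrt (real p)],
                     vector [of_int k * sqrt (real p), of_int (- m)]] \<in> R_group p" (is "?A \<in> _")
    by (intro R_group_diagonal_integral) (simp add: k algebra_simps)
  moreover have "moebius ?A (Some (of_real r)) = pt_infinity"
  proof (rule moebius_eq_infinity)
    \<comment> \<open>Scaled by the nonzero \<open>sqrt (real p)\<close>, the denominator at
      \<open>r\<close> becomes \<open>of_int n * r - of_int m * sqrt (real p)\<close>.\<close>
    have "sqrt (real p) * (of_int k * sqrt (real p) * r - of_int m) = 0"
      using r k by (simp add: right_diff_distrib mult_ac real_sqrt_mult_self_left)
    then show "?A $ 2 $ 1 * r + ?A $ 2 $ 2 = 0"
      using prime_gt_0_nat[OF p] by simp
  qed
  ultimately show ?thesis unfolding equivalent_under_def by blast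
next
  case False
  \<comment> \<open>The extra factor \<open>int p\<close> is needed because the second shape has
    determinant \<open>int p * (s * m) + t * n\<close>, with the top row again from Bezout.\<close>
  then have "coprime (int p * m) n"
    using p mn(1) by (simp add: prime_imp_coprime)
  then obtain s t where "s * (int p * m) + t * n = 1"
    using bezout_int[of "int p * m" n] by auto
  then have "vector [vector [of_int (- s) * sqrt (real p), of_int (- t)],
                     vector [of_int n, of_int (- m) * sqrt (real p)]] \<in> R_group p" (is "?A \<in> _")
    by (intro R_group_antidiagonal_integral) (simp add: algebra_simps)
  moreover have "moebius ?A (Some (of_real r)) = pt_infinity"
    using r by (intro moebius_eq_infinity) simp
  ultimately show ?thesis unfolding equivalent_under_def by blast
qed

theorem proposition2p8:
  fixes p :: nat and x :: "complex option"
  assumes "prime p"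
    and "is_cusp (R_group p) x"
  shows "equivalent_under (R_group p) x pt_infinity"
proof (cases x)
  case None
  \<comment> \<open>The identity, seen as an instance of the first shape.\<close>
  have "vector [vector [of_int 1, of_int 0 * sqrt (real p)],
                vector [of_int 0 * sqrt (real p), of_int 1]] \<in> R_group p" (is "?A \<in> _")
    by (rule R_group_diagonal_integral) simp
  moreover have "moebius ?A None = pt_infinity"
    by simp
  ultimately show ?thesis
    unfolding None equivalent_under_def by blast
next
  case (Some z)
  from assms(2) obtain A where A: "A \<in> R_group p" "parabolic A" "moebius A x = x"
    and "x \<in> extended_real_line"
    unfolding is_cusp_def by blast
  with Some obtain r where r: "x = Some (of_real r)"
    by (auto simp: extended_real_line_def Reals_def)
  obtain m n :: int where "n \<noteq> 0" "coprime m n" "of_int n * r = of_int m * sqrt (real p)"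
    using cusp_R_group_real[OF prime_gt_0_nat[OF assms(1)] A(1,2) A(3)[unfolded r]] .
  then show ?thesis
    unfolding r by (intro equivalent_under_R_group_infinity[OF assms(1)])
qed

end
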